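(* Let $\mu$ be a minimal, $\sigma$-invariant ergodic probability measure on $\Sigma_N$. Then $x\mapsto r_x$ is constant $\mu$-almost everywhere.
   Context: $S_1,\dots,S_N$ are uniformly expanding compatible substitution rules on compact prototiles $t_1,\dots,t_M\subset\mathbb{R}^d$: each $S_\ell$ consists of maps $f_{ijk}(y)=\theta_\ell y+\tau_{ijk}$ ($1\le k\le\kappa_\ell(i,j)$), $\theta_\ell\in(0,1)$, with $t_i=\bigcup_j\bigcup_kf_{ijk}(t_j)$, pieces meeting along boundaries; substitution matrix $F^{(\ell)}_{ij}=\kappa_\ell(i,j)$; compatibility means supertiles are tiled edge-to-edge so tilings have finite local complexity. $\Sigma_N=\{1,\dots,N\}^{\mathbb{Z}\setminus\{0\}}$ with shift $\sigma$. $\mu$ is minimal if for $\mu$-a.e. $x$ and every $m$ some product $F^{(x_n)}\cdots F^{(x_m)}$, $n>m$, is strictly positive. For such $x$, a level-$k$ supertile of type $i$ is $(\theta_{x_1}\cdots\theta_{x_k})^{-1}t_i$ subdivided by successively applying $S_{x_k},\dots,S_{x_1}$, and $\Omega_x$ is the tiling space of tilings which are increasing unions of such supertiles. $\Lambda_x$ is the set of $\tau$ such that some tiling of $\Omega_x$ contains tiles $t$ and $t+\tau$ that are translates of the same prototile; $r_x$ is the rank of the group $\Gamma_x=\mathbb{Z}[\Lambda_x]$. *)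

theory Defs
  imports "HOL-Probability.Probability"
begin

text \<open>Prototiles are indexed by 1..M, substitution rules by 1..N.
  Parameters: t i (prototile), th l (contraction ratio theta_l),
  ka l i j (number kappa_l(i,j) of copies of t_j in the S_l-subdivision of t_i),
  ta l i j k (translation tau_{ijk} of rule S_l, k < ka l i j).\<close>

definition subst_rules ::
  "nat \<Rightarrow> nat \<Rightarrow> (nat \<Rightarrow> 'a::euclidean_space set) \<Rightarrow> (nat \<Rightarrow> real)
    \<Rightarrow> (nat \<Rightarrow> nat \<Rightarrow> nat \<Rightarrow> nat) \<Rightarrow> (nat \<Rightarrow> nat \<Rightarrow> nat \<Rightarrow> nat \<Rightarrow> 'a) \<Rightarrow> bool" where
  "subst_rules M N t th ka ta \<longleftrightarrow>
     (\<forall>i\<in>{1..M}. compact (t i)) \<and>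
     (\<forall>l\<in>{1..N}. 0 < th l \<and> th l < 1 \<and>
        (\<forall>i\<in>{1..M}. t i = (\<Union>j\<in>{1..M}. \<Union>k\<in>{..<ka l i j}.
                                  (\<lambda>y. th l *\<^sub>R y + ta l i j k) ` t j)) \<and>
        (\<forall>i\<in>{1..M}. \<forall>j\<in>{1..M}. \<forall>j'\<in>{1..M}. \<forall>k<ka l i j. \<forall>k'<ka l i j'.
            (j, k) \<noteq> (j', k') \<longrightarrow>
            interior ((\<lambda>y. th l *\<^sub>R y + ta l i j k) ` t j)
              \<inter> interior ((\<lambda>y. th l *\<^sub>R y + ta l i j' k') ` t j') = {}))"

text \<open>The sequence space Sigma_N = {1..N}^(Z - {0}) with its product sigma-algebra
  (functions are extensional: value undefined at 0).\<close>

definition SigmaM :: "nat \<Rightarrow> (int \<Rightarrow> nat) measure" where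
  "SigmaM N = Pi\<^sub>M (UNIV - {0}) (\<lambda>_. count_space {1..N})"

text \<open>Left shift on Z - {0}: (sigma x)_n = x_{n+1} for n \<noteq> -1, (sigma x)_{-1} = x_1.\<close>

definition shiftS :: "(int \<Rightarrow> nat) \<Rightarrow> (int \<Rightarrow> nat)" where
  "shiftS x = (\<lambda>n. if n = 0 then undefined else x (if n = -1 then 1 else n + 1))"

definition ergodic_shift :: "(int \<Rightarrow> nat) measure \<Rightarrow> bool" where
  "ergodic_shift \<mu> \<longleftrightarrow>
     (\<forall>A\<in>sets \<mu>. shiftS -` A \<inter> space \<mu> = A \<longrightarrow> measure \<mu> A = 0 \<or> measure \<mu> A = 1)"

text \<open>Entries of the matrix product F^(l_1) F^(l_2) ... F^(l_r) for the list [l_1,...,l_r],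
  where F^(l)_{ij} = ka l i j, i,j \<in> {1..M}.\<close>

fun mprod :: "nat \<Rightarrow> (nat \<Rightarrow> nat \<Rightarrow> nat \<Rightarrow> nat) \<Rightarrow> nat list \<Rightarrow> nat \<Rightarrow> nat \<Rightarrow> nat" where
  "mprod M ka [] i j = (if i = j then 1 else 0)"
| "mprod M ka (l # ls) i j = (\<Sum>m\<in>{1..M}. ka l i m * mprod M ka ls m j)"

text \<open>F^(x_n) ... F^(x_m) (indices in Z - {0}, from n down to m).\<close>

definition prod_seg :: "nat \<Rightarrow> (nat \<Rightarrow> nat \<Rightarrow> nat \<Rightarrow> nat) \<Rightarrow> (int \<Rightarrow> nat) \<Rightarrow> int \<Rightarrow> int
    \<Rightarrow> nat \<Rightarrow> nat \<Rightarrow> nat" where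
  "prod_seg M ka x n m = mprod M ka (map x (filter (\<lambda>k. k \<noteq> 0) (rev [m..n])))"

definition minimal_measure :: "nat \<Rightarrow> (nat \<Rightarrow> nat \<Rightarrow> nat \<Rightarrow> nat) \<Rightarrow> (int \<Rightarrow> nat) measure \<Rightarrow> bool" where
  "minimal_measure M ka \<mu> \<longleftrightarrow>
     (AE x in \<mu>. \<forall>m. m \<noteq> 0 \<longrightarrow>
        (\<exists>n. n \<noteq> 0 \<and> n > m \<and> (\<forall>i\<in>{1..M}. \<forall>j\<in>{1..M}. prod_seg M ka x n m i j > 0)))"

text \<open>Theta_k = theta_{x_1} ... theta_{x_k}.\<close>

definition Theta :: "(nat \<Rightarrow> real) \<Rightarrow> (int \<Rightarrow> nat) \<Rightarrow> nat \<Rightarrow> real" where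
  "Theta th x k = (\<Prod>n\<in>{1..k}. th (x (int n)))"

text \<open>Level-k supertile of type i, as a set of labelled tiles (j, v), where (j, v) stands for
  the tile v + t_j. It is Theta_k^{-1} t_i subdivided by S_{x_k}, ..., S_{x_1}.\<close>

primrec supertile :: "nat \<Rightarrow> (nat \<Rightarrow> real) \<Rightarrow> (nat \<Rightarrow> nat \<Rightarrow> nat \<Rightarrow> nat)
    \<Rightarrow> (nat \<Rightarrow> nat \<Rightarrow> nat \<Rightarrow> nat \<Rightarrow> 'a::euclidean_space) \<Rightarrow> (int \<Rightarrow> nat) \<Rightarrow> nat \<Rightarrow> nat
    \<Rightarrow> (nat \<times> 'a) set" where
  "supertile M th ka ta x 0 i = {(i, 0)}"
| "supertile M th ka ta x (Suc k) i =
     (\<Union>j\<in>{1..M}. \<Union>q\<in>{..<ka (x (int (Suc k))) i j}.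
        (\<lambda>(m, v). (m, v + (1 / Theta th x (Suc k)) *\<^sub>R ta (x (int (Suc k))) i j q))
          ` supertile M th ka ta x k j)"

definition translate_patch :: "'a::euclidean_space \<Rightarrow> (nat \<times> 'a) set \<Rightarrow> (nat \<times> 'a) set" where
  "translate_patch w P = (\<lambda>(j, v). (j, v + w)) ` P"

definition tile_set :: "(nat \<Rightarrow> 'a::euclidean_space set) \<Rightarrow> nat \<times> 'a \<Rightarrow> 'a set" where
  "tile_set t jv = (\<lambda>y. snd jv + y) ` t (fst jv)"

text \<open>Compatibility, expressed through its consequence used in the paper: finite local
  complexity of all supertiles (finitely many intersecting pairs of tiles up to translation),
  uniformly over all sequences in Sigma_N.\<close>

definition compatible ::
  "nat \<Rightarrow> nat \<Rightarrow> (nat \<Rightarrow> 'a::euclidean_space set) \<Rightarrow> (nat \<Rightarrow> real)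
    \<Rightarrow> (nat \<Rightarrow> nat \<Rightarrow> nat \<Rightarrow> nat) \<Rightarrow> (nat \<Rightarrow> nat \<Rightarrow> nat \<Rightarrow> nat \<Rightarrow> 'a) \<Rightarrow> bool" where
  "compatible M N t th ka ta \<longleftrightarrow>
     (\<exists>F. finite F \<and>
        (\<forall>x\<in>space (SigmaM N). \<forall>k i. i \<in> {1..M} \<longrightarrow>
          (\<forall>p\<in>supertile M th ka ta x k i. \<forall>p'\<in>supertile M th ka ta x k i.
             tile_set t p \<inter> tile_set t p' \<noteq> {} \<longrightarrow> (fst p, fst p', snd p' - snd p) \<in> F)))"

text \<open>Omega_x: tilings of R^d which are increasing unions of (translated) supertiles.\<close>

definition Omega :: "nat \<Rightarrow> (nat \<Rightarrow> 'a::euclidean_space set) \<Rightarrow> (nat \<Rightarrow> real)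
    \<Rightarrow> (nat \<Rightarrow> nat \<Rightarrow> nat \<Rightarrow> nat) \<Rightarrow> (nat \<Rightarrow> nat \<Rightarrow> nat \<Rightarrow> nat \<Rightarrow> 'a) \<Rightarrow> (int \<Rightarrow> nat)
    \<Rightarrow> (nat \<times> 'a) set set" where
  "Omega M t th ka ta x = {T.
     (\<exists>(typ :: nat \<Rightarrow> nat) (w :: nat \<Rightarrow> 'a).
        (\<forall>k. typ k \<in> {1..M}) \<and>
        (\<forall>k. translate_patch (w k) (supertile M th ka ta x k (typ k))
              \<subseteq> translate_patch (w (Suc k)) (supertile M th ka ta x (Suc k) (typ (Suc k)))) \<and>
        T = (\<Union>k. translate_patch (w k) (supertile M th ka ta x k (typ k)))) \<and>
     (\<Union>p\<in>T. tile_set t p) = UNIV}"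

text \<open>Lambda_x: return vectors between tiles of the same type in some tiling of Omega_x.\<close>

definition Lambda :: "nat \<Rightarrow> (nat \<Rightarrow> 'a::euclidean_space set) \<Rightarrow> (nat \<Rightarrow> real)
    \<Rightarrow> (nat \<Rightarrow> nat \<Rightarrow> nat \<Rightarrow> nat) \<Rightarrow> (nat \<Rightarrow> nat \<Rightarrow> nat \<Rightarrow> nat \<Rightarrow> 'a) \<Rightarrow> (int \<Rightarrow> nat) \<Rightarrow> 'a set" where
  "Lambda M t th ka ta x =
     {u. \<exists>T\<in>Omega M t th ka ta x. \<exists>j v. (j, v) \<in> T \<and> (j, v + u) \<in> T}"

text \<open>Z[S]: the subgroup generated by S (integer linear combinations).\<close>

definition int_span :: "'a::real_vector set \<Rightarrow> 'a set" where
  "int_span S = {\<Sum>s\<in>F. of_int (c s) *\<^sub>R s | F c. finite F \<and> F \<subseteq> S}"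

definition int_indep :: "'a::real_vector set \<Rightarrow> bool" where
  "int_indep S \<longleftrightarrow> (\<forall>c :: 'a \<Rightarrow> int. (\<Sum>s\<in>S. of_int (c s) *\<^sub>R s) = 0 \<longrightarrow> (\<forall>s\<in>S. c s = 0))"

text \<open>Rank of an abelian group G \<subseteq> R^d: sup of sizes of finite Z-independent subsets.\<close>

definition group_rank :: "'a::real_vector set \<Rightarrow> enat" where
  "group_rank G = (SUP S \<in> {S. finite S \<and> S \<subseteq> G \<and> int_indep S}. enat (card S))"

definition rank_x :: "nat \<Rightarrow> (nat \<Rightarrow> 'a::euclidean_space set) \<Rightarrow> (nat \<Rightarrow> real)
    \<Rightarrow> (nat \<Rightarrow> nat \<Rightarrow> nat \<Rightarrow> nat) \<Rightarrow> (nat \<Rightarrow> nat \<Rightarrow> nat \<Rightarrow> nat \<Rightarrow> 'a) \<Rightarrow> (int \<Rightarrow> nat) \<Rightarrow> enat" where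
  "rank_x M t th ka ta x = group_rank (int_span (Lambda M t th ka ta x))"

end

theory Submission
  imports Defs
begin

text \<open>For a minimal sequence x every tiling in Omega_x contains a translate of every
  supertile, so Lambda_x is the set R_x of return vectors within single supertiles as soon as
  Omega_x is nonempty. If some prototile has interior points, Omega_x is nonempty: concatenating
  towers of nested supertiles whose supports contain larger and larger balls yields a tiling.
  Otherwise Baire's theorem shows that Omega_x is empty for every x, and r_x is trivially
  constant. A level-k supertile for the shifted sequence, scaled by 1/theta_(x_1), lies in a
  level-(k+1) supertile for x, so the rank of Z[R_x] does not increase along the shift. Its
  superlevel sets depend on finitely many coordinates at a time, hence are measurable, and a
  measurable shift-subinvariant set of an ergodic shift has measure 0 or 1.\<close>

section \<open>Preliminaries\<close>

lemma sum_atLeastLessThan_if_less: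
  fixes k m n :: nat
  assumes "k \<le> m" "m \<le> n"
  shows "(\<Sum>l\<in>{k..<n}. if l < m then f l else g l) = sum f {k..<m} + sum g {m..<n}"
  unfolding sum.atLeastLessThan_concat[OF assms, symmetric]
  by (intro arg_cong2[where f = "(+)"] sum.cong) auto

lemma strict_mono_segment:
  fixes K :: "nat \<Rightarrow> nat"
  assumes K: "strict_mono K" "K 0 = 0"
  shows "\<exists>!m. K m \<le> l \<and> l < K (Suc m)"
proof -
  define m where "m = (LEAST m. l < K (Suc m))"
  have "l < K (Suc l)"
    using strict_mono_imp_increasing[OF K(1), of "Suc l"] by simp
  then have lt: "l < K (Suc m)" unfolding m_def by (rule LeastI)
  have le: "K m \<le> l"
  proof (cases m)
    case (Suc m')
    then have "\<not> l < K (Suc m')"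
      using not_less_Least[of m' "\<lambda>m. l < K (Suc m)"] unfolding m_def by simp
    then show ?thesis using Suc by simp
  qed (simp add: K(2))
  have "m' = m" if "K m' \<le> l" "l < K (Suc m')" for m'
  proof -
    have "K m' < K (Suc m)" "K m < K (Suc m')" using that le lt by linarith+
    then show ?thesis by (simp add: strict_mono_less[OF K(1)])
  qed
  then show ?thesis using le lt by blast
qed

lemma upto_of_nat: "[int a..int b] = map int [a..<Suc b]"
proof (induction b)
  case (Suc b)
  show ?case
  proof (cases "a \<le> Suc b")
    case True
    have "[int a..int (Suc b)] = [int a..int (Suc b) - 1] @ [int (Suc b)]"
      using True by (intro upto_rec2) simp
    then show ?thesis using Suc.IH True by simp
  qed simp
qed (cases a; simp)

lemma UN_eq_UNIV_if_cball_step: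
  fixes R :: "nat \<Rightarrow> 'a::metric_space set"
  assumes "z \<in> R 0" and step: "\<And>m y. y \<in> R m \<Longrightarrow> cball y (real m) \<subseteq> R (Suc m)"
  shows "(\<Union>m. R m) = UNIV"
proof -
  have z: "z \<in> R m" for m
  proof (induction m)
    case (Suc m)
    then show ?case using step[OF Suc] by auto
  qed (rule assms(1))
  have "p \<in> R (Suc (nat \<lceil>dist z p\<rceil>))" for p
    using step[OF z, of "nat \<lceil>dist z p\<rceil>"] by (simp add: subset_iff)
  then show ?thesis by blast
qed

lemma Baire_UN_neq_UNIV:
  fixes G :: "'a::euclidean_space set set"
  assumes "countable G" "\<And>T. T \<in> G \<Longrightarrow> closed T \<and> interior T = {}"
  shows "\<Union>G \<noteq> UNIV"
  using Baire_category_alt[of euclidean G] completely_metrizable_space_euclidean assms by force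

section \<open>Sequences of substitution rules\<close>

definition valid_seq :: "nat \<Rightarrow> (int \<Rightarrow> nat) \<Rightarrow> bool" where
  "valid_seq N x \<longleftrightarrow> (\<forall>n. n \<noteq> 0 \<longrightarrow> x n \<in> {1..N})"

lemma space_SigmaM: "space (SigmaM N) = {x. (\<forall>n. n \<noteq> 0 \<longrightarrow> x n \<in> {1..N}) \<and> x 0 = undefined}"
  unfolding SigmaM_def space_PiM PiE_def Pi_def extensional_def by auto

lemma valid_seq_if_in_space: "x \<in> space (SigmaM N) \<Longrightarrow> valid_seq N x"
  unfolding space_SigmaM valid_seq_def by auto

lemma shiftS_Suc: "shiftS x (int (Suc k)) = x (int (Suc (Suc k)))"
  unfolding shiftS_def by simp

lemma Theta_0 [simp]: "Theta th x 0 = 1"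
  unfolding Theta_def by simp

lemma Theta_Suc: "Theta th x (Suc k) = Theta th x k * th (x (int (Suc k)))"
  unfolding Theta_def by (simp add: prod.nat_ivl_Suc' mult.commute)

lemma Theta_Suc_shiftS: "Theta th x (Suc k) = th (x 1) * Theta th (shiftS x) k"
proof (induction k)
  case (Suc k)
  have "Theta th x (Suc (Suc k)) = th (x 1) * (Theta th (shiftS x) k * th (shiftS x (int (Suc k))))"
    by (simp only: Theta_Suc[of th x "Suc k"] Suc shiftS_Suc mult.assoc)
  then show ?case by (simp only: Theta_Suc)
qed (simp add: Theta_Suc)

lemma Theta_cong: "(\<And>l. l \<in> {1..k} \<Longrightarrow> x (int l) = y (int l)) \<Longrightarrow> Theta th x k = Theta th y k"
  unfolding Theta_def by (intro prod.cong) auto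

lemma sets_SigmaM_if_depends_on_initial:
  assumes dep: "\<And>x y. x \<in> space (SigmaM N) \<Longrightarrow> y \<in> space (SigmaM N) \<Longrightarrow>
      (\<forall>l\<in>{1..K}. x (int l) = y (int l)) \<Longrightarrow> P x \<longleftrightarrow> P y"
  shows "{x \<in> space (SigmaM N). P x} \<in> sets (SigmaM N)"
proof -
  define r where "r x = (\<lambda>l\<in>{1..K}. x (int l))" for x :: "int \<Rightarrow> nat"
  have "r \<in> SigmaM N \<rightarrow>\<^sub>M Pi\<^sub>M {1..K} (\<lambda>_. count_space {1..N})"
    unfolding r_def SigmaM_def by (intro measurable_restrict measurable_component_singleton) auto
  then have r: "r \<in> SigmaM N \<rightarrow>\<^sub>M count_space (Pi\<^sub>E {1..K} (\<lambda>_. {1..N}))"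
    by (simp add: count_space_PiM_finite)
  have "{x \<in> space (SigmaM N). P x} = r -` (r ` {x \<in> space (SigmaM N). P x}) \<inter> space (SigmaM N)"
  proof (intro set_eqI iffI)
    fix x assume "x \<in> r -` (r ` {x \<in> space (SigmaM N). P x}) \<inter> space (SigmaM N)"
    then obtain y where x: "x \<in> space (SigmaM N)" and y: "y \<in> space (SigmaM N)" "P y"
      and eq: "r x = r y" by auto
    have "x (int l) = y (int l)" if "l \<in> {1..K}" for l
      using fun_cong[OF eq, of l] that unfolding r_def by simp
    then show "x \<in> {x \<in> space (SigmaM N). P x}"
      using dep[OF x y(1)] x y(2) by blast
  qed auto
  also have "\<dots> \<in> sets (SigmaM N)"
    using measurable_space[OF r] by (intro measurable_sets[OF r]) auto
  finally show ?thesis .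
qed

section \<open>Shift-subinvariant functions\<close>

lemma (in prob_space) ex_if_AE:
  assumes "AE x in M. P x"
  shows "\<exists>x. P x"
proof (rule eventually_happens'[OF _ assms])
  show "ae_filter M \<noteq> bot"
    using AE_False by (auto simp flip: eventually_False)
qed

lemma enat_eqI_nat_le:
  fixes a b :: enat
  assumes "\<And>c. enat c \<le> a \<longleftrightarrow> enat c \<le> b"
  shows "a = b"
  using assms[of "Suc (the_enat a)"] assms[of "Suc (the_enat b)"] assms[of "the_enat a"]
    assms[of "the_enat b"]
  by (cases a; cases b) auto

lemma (in prob_space) AE_eq_const_if_level_sets_trivial:
  fixes g :: "'a \<Rightarrow> enat"
  assumes sets: "\<And>c. {x \<in> space M. enat c \<le> g x} \<in> events"
    and trivial: "\<And>c. prob {x \<in> space M. enat c \<le> g x} \<in> {0, 1}"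
  shows "\<exists>r. AE x in M. g x = r"
proof -
  let ?E = "\<lambda>c. {x \<in> space M. enat c \<le> g x}"
  have "AE x in M. enat c \<le> g x \<longleftrightarrow> prob (?E c) = 1" for c
  proof (cases "prob (?E c) = 1")
    case True
    have "AE x in M. x \<in> ?E c" by (rule AE_prob_1[OF True])
    then show ?thesis by eventually_elim (simp add: True)
  next
    case False
    then have "AE x in M. x \<notin> ?E c" using trivial prob_eq_0[OF sets] by auto
    with AE_space show ?thesis by eventually_elim (use False in auto)
  qed
  then have AE_levels: "AE x in M. \<forall>c. enat c \<le> g x \<longleftrightarrow> prob (?E c) = 1"
    by (simp add: AE_all_countable)
  then obtain x0 where x0: "\<forall>c. enat c \<le> g x0 \<longleftrightarrow> prob (?E c) = 1"
    using ex_if_AE by blast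
  have "AE x in M. g x = g x0"
    using AE_levels by eventually_elim (use x0 in \<open>simp add: enat_eqI_nat_le\<close>)
  then show ?thesis by blast
qed

lemma ergodic_shift_trivial_if_subinvariant:
  assumes prob: "prob_space \<mu>" and shift_meas: "shiftS \<in> \<mu> \<rightarrow>\<^sub>M \<mu>"
    and invariant: "distr \<mu> \<mu> shiftS = \<mu>" and ergodic: "ergodic_shift \<mu>"
    and E: "E \<in> sets \<mu>" and sub: "shiftS -` E \<inter> space \<mu> \<subseteq> E"
  shows "measure \<mu> E \<in> {0, 1}"
proof -
  interpret prob_space \<mu> by (rule prob)
  define pre where "pre A = shiftS -` A \<inter> space \<mu>" for A
  define A where "A n = (pre ^^ n) E" for n
  have A_Suc: "A (Suc n) = pre (A n)" for n unfolding A_def by simp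
  have A_sets: "A n \<in> sets \<mu>" for n
  proof (induction n)
    case (Suc n)
    then show ?case unfolding A_Suc pre_def by (rule measurable_sets[OF shift_meas])
  qed (simp add: A_def E)
  have A_measure: "measure \<mu> (A n) = measure \<mu> E" for n
  proof (induction n)
    case (Suc n)
    then show ?case
      using measure_distr[OF shift_meas A_sets[of n]] unfolding invariant A_Suc pre_def by simp
  qed (simp add: A_def)
  have A_decseq: "decseq A"
  proof (rule decseq_SucI)
    show "A (Suc n) \<subseteq> A n" for n
      by (induction n) (use sub in \<open>auto simp: A_Suc pre_def A_def\<close>)
  qed
  have "(\<lambda>n. measure \<mu> (A n)) \<longlonglongrightarrow> measure \<mu> (\<Inter>n. A n)"
    using A_sets A_decseq by (intro finite_Lim_measure_decseq) auto
  then have measure_Inter: "measure \<mu> (\<Inter>n. A n) = measure \<mu> E"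
    unfolding A_measure by (simp add: LIMSEQ_const_iff)
  have "pre (\<Inter>n. A n) = (\<Inter>n. A (Suc n))"
    unfolding A_Suc pre_def by blast
  also have "\<dots> = (\<Inter>n. A n)"
    using A_decseq by (auto simp: decseq_Suc_iff)
  finally have "measure \<mu> (\<Inter>n. A n) = 0 \<or> measure \<mu> (\<Inter>n. A n) = 1"
    using ergodic A_sets unfolding ergodic_shift_def pre_def by blast
  then show ?thesis unfolding measure_Inter by simp
qed

section \<open>Rank of subgroups of a real vector space\<close>

lemma int_span_mono: "A \<subseteq> B \<Longrightarrow> int_span A \<subseteq> int_span B"
  unfolding int_span_def by blast

lemma subset_chain_range_if_incseq:
  fixes B :: "nat \<Rightarrow> 'a set"
  assumes "incseq B"
  shows "subset.chain UNIV (range B)"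
  unfolding subset_chain_def
proof (intro conjI ballI subset_UNIV)
  fix X Y assume "X \<in> range B" "Y \<in> range B"
  then obtain m n where "X = B m" "Y = B n" by blast
  then show "X \<subseteq> Y \<or> Y \<subseteq> X"
    using assms[unfolded incseq_def] nat_le_linear[of m n] by blast
qed

lemma int_span_UN_incseq:
  assumes "finite S" "S \<subseteq> int_span (\<Union>K. A K)" and "incseq A"
  shows "\<exists>K. S \<subseteq> int_span (A K)"
proof -
  have "S \<subseteq> \<Union>(range (\<lambda>K. int_span (A K)))"
  proof
    fix s assume "s \<in> S"
    then obtain F c where F: "finite F" "F \<subseteq> \<Union>(range A)" and s: "s = (\<Sum>x\<in>F. of_int (c x) *\<^sub>R x)"
      using assms(2) unfolding int_span_def by blast
    obtain K where "F \<subseteq> A K"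
      using finite_subset_Union_chain[OF F _ subset_chain_range_if_incseq[OF assms(3)]] by blast
    then show "s \<in> \<Union>(range (\<lambda>K. int_span (A K)))"
      unfolding int_span_def s using F(1) by blast
  qed
  moreover have "incseq (\<lambda>K. int_span (A K))"
    using assms(3) by (simp add: incseq_def int_span_mono)
  ultimately show ?thesis
    using finite_subset_Union_chain[OF assms(1) _ _ subset_chain_range_if_incseq] by blast
qed

lemma int_span_image_scaleR:
  "(*\<^sub>R) c ` int_span A \<subseteq> int_span ((*\<^sub>R) c ` A)" if "c \<noteq> 0" for c :: real
proof
  fix y assume "y \<in> (*\<^sub>R) c ` int_span A"
  then obtain F f where F: "finite F" "F \<subseteq> A" and y: "y = c *\<^sub>R (\<Sum>s\<in>F. of_int (f s) *\<^sub>R s)"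
    unfolding int_span_def by blast
  have inj: "inj_on ((*\<^sub>R) c) F" using that by (auto intro: inj_onI)
  have "(\<Sum>b\<in>(*\<^sub>R) c ` F. of_int (f ((1 / c) *\<^sub>R b)) *\<^sub>R b) = (\<Sum>s\<in>F. of_int (f s) *\<^sub>R (c *\<^sub>R s))"
    using that by (simp add: sum.reindex[OF inj])
  also have "\<dots> = y" unfolding y scaleR_sum_right by (simp add: ac_simps)
  finally show "y \<in> int_span ((*\<^sub>R) c ` A)"
    unfolding int_span_def mem_Collect_eq using F
    by (intro exI[of _ "(*\<^sub>R) c ` F"] exI[of _ "\<lambda>b. f ((1 / c) *\<^sub>R b)"]) auto
qed

lemma int_indep_image_scaleR:
  "int_indep ((*\<^sub>R) c ` S)" if "c \<noteq> 0" "int_indep S" for c :: real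
  unfolding int_indep_def
proof (intro allI impI ballI)
  fix f :: "'a \<Rightarrow> int" and b
  assume sum0: "(\<Sum>s\<in>(*\<^sub>R) c ` S. of_int (f s) *\<^sub>R s) = 0" and b: "b \<in> (*\<^sub>R) c ` S"
  have inj: "inj_on ((*\<^sub>R) c) S" using that by (auto intro: inj_onI)
  have "c *\<^sub>R (\<Sum>s\<in>S. of_int (f (c *\<^sub>R s)) *\<^sub>R s) = 0"
    using sum0 unfolding sum.reindex[OF inj] scaleR_sum_right by (simp add: ac_simps)
  then have "\<forall>s\<in>S. f (c *\<^sub>R s) = 0"
    using that spec[OF that(2)[unfolded int_indep_def], of "\<lambda>s. f (c *\<^sub>R s)"] by simp
  then show "f b = 0" using b by blast
qed

lemma group_rank_int_span_mono_scaleR: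
  assumes "c \<noteq> 0" and "(*\<^sub>R) c ` A \<subseteq> B"
  shows "group_rank (int_span A) \<le> group_rank (int_span B)"
  unfolding group_rank_def
proof (rule SUP_mono)
  fix S assume "S \<in> {S. finite S \<and> S \<subseteq> int_span A \<and> int_indep S}"
  then have S: "finite S" "S \<subseteq> int_span A" "int_indep S" by auto
  have "(*\<^sub>R) c ` S \<subseteq> int_span B"
    using S(2) int_span_image_scaleR[OF assms(1)] int_span_mono[OF assms(2)] by blast
  moreover have "card ((*\<^sub>R) c ` S) = card S"
    using assms(1) by (intro card_image inj_onI) auto
  ultimately show "\<exists>S'\<in>{S. finite S \<and> S \<subseteq> int_span B \<and> int_indep S}. enat (card S) \<le> enat (card S')"
    using S int_indep_image_scaleR[OF assms(1) S(3)] by (intro bexI[of _ "(*\<^sub>R) c ` S"]) auto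
qed

lemma enat_le_group_rank_iff:
  "enat c \<le> group_rank G \<longleftrightarrow> (\<exists>S. finite S \<and> S \<subseteq> G \<and> int_indep S \<and> c \<le> card S)"
proof
  assume "\<exists>S. finite S \<and> S \<subseteq> G \<and> int_indep S \<and> c \<le> card S"
  then obtain S where S: "finite S" "S \<subseteq> G" "int_indep S" "c \<le> card S" by blast
  have "enat (card S) \<le> group_rank G" unfolding group_rank_def using S by (intro SUP_upper) auto
  then show "enat c \<le> group_rank G" using S(4) by (meson enat_ord_simps(1) order.trans)
next
  assume le: "enat c \<le> group_rank G"
  show "\<exists>S. finite S \<and> S \<subseteq> G \<and> int_indep S \<and> c \<le> card S"
  proof (cases c)
    case 0 then show ?thesis by (intro exI[of _ "{}"]) (auto simp: int_indep_def)
  next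
    case (Suc c')
    then have "enat c' < group_rank G" using le by (metis Suc_ile_eq)
    then show ?thesis using Suc unfolding group_rank_def less_SUP_iff by auto
  qed
qed

section \<open>Patches\<close>

definition patch_support :: "(nat \<Rightarrow> 'a::euclidean_space set) \<Rightarrow> (nat \<times> 'a) set \<Rightarrow> 'a set" where
  "patch_support t P = (\<Union>p\<in>P. tile_set t p)"

lemma patch_support_mono: "P \<subseteq> Q \<Longrightarrow> patch_support t P \<subseteq> patch_support t Q"
  unfolding patch_support_def by blast

lemma patch_support_UN: "patch_support t (\<Union>i\<in>I. P i) = (\<Union>i\<in>I. patch_support t (P i))"
  unfolding patch_support_def by blast

lemma translate_patch_0 [simp]: "translate_patch 0 P = P"
  unfolding translate_patch_def by (force simp: image_iff)

lemma translate_patch_translate_patch: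
  "translate_patch a (translate_patch b P) = translate_patch (b + a) P"
  unfolding translate_patch_def by (force simp: image_image add.assoc)

lemma translate_patch_mono: "P \<subseteq> Q \<Longrightarrow> translate_patch a P \<subseteq> translate_patch a Q"
  unfolding translate_patch_def by (rule image_mono)

lemma mem_translate_patch: "(j, v) \<in> translate_patch w P \<longleftrightarrow> (j, v - w) \<in> P"
  unfolding translate_patch_def by (force simp: image_iff)

lemma finite_translate_patch: "finite P \<Longrightarrow> finite (translate_patch w P)"
  unfolding translate_patch_def by (rule finite_imageI)

lemma patch_support_translate_patch:
  "patch_support t (translate_patch w P) = (+) w ` patch_support t P"
  unfolding patch_support_def translate_patch_def tile_set_def
  by (auto simp: image_UN image_image add_ac split: prod.splits)

definition return_vectors :: "(nat \<times> 'a::euclidean_space) set \<Rightarrow> 'a set" where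
  "return_vectors P = {u. \<exists>j v. (j, v) \<in> P \<and> (j, v + u) \<in> P}"

lemma return_vectors_mono: "P \<subseteq> Q \<Longrightarrow> return_vectors P \<subseteq> return_vectors Q"
  unfolding return_vectors_def by blast

lemma return_vectors_translate_patch: "return_vectors (translate_patch w P) = return_vectors P"
proof -
  have "(\<exists>j v. (j, v - w) \<in> P \<and> (j, v + u - w) \<in> P) \<longleftrightarrow> (\<exists>j v. (j, v) \<in> P \<and> (j, v + u) \<in> P)" for u
    by (metis (no_types, opaque_lifting) add_diff_cancel diff_add_eq)
  then show ?thesis
    unfolding return_vectors_def mem_translate_patch by simp
qed

lemma Lambda_eq_UN_return_vectors:
  "Lambda M t th ka ta x = (\<Union>T\<in>Omega M t th ka ta x. return_vectors T)"
  unfolding Lambda_def return_vectors_def by blast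

section \<open>Supertiles\<close>

locale subst_system =
  fixes M N :: nat and t :: "nat \<Rightarrow> 'a::euclidean_space set" and th :: "nat \<Rightarrow> real"
    and ka :: "nat \<Rightarrow> nat \<Rightarrow> nat \<Rightarrow> nat" and ta :: "nat \<Rightarrow> nat \<Rightarrow> nat \<Rightarrow> nat \<Rightarrow> 'a"
  assumes rules: "subst_rules M N t th ka ta"
begin

abbreviation ST :: "(int \<Rightarrow> nat) \<Rightarrow> nat \<Rightarrow> nat \<Rightarrow> (nat \<times> 'a) set" where
  "ST x k i \<equiv> supertile M th ka ta x k i"

abbreviation inflated :: "(int \<Rightarrow> nat) \<Rightarrow> nat \<Rightarrow> nat \<Rightarrow> 'a set" where
  "inflated x k i \<equiv> (*\<^sub>R) (1 / Theta th x k) ` t i"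

lemma th_pos: "l \<in> {1..N} \<Longrightarrow> 0 < th l"
  using rules unfolding subst_rules_def by blast

lemma th_less_1: "l \<in> {1..N} \<Longrightarrow> th l < 1"
  using rules unfolding subst_rules_def by blast

lemma prototile_eq_UN:
  "l \<in> {1..N} \<Longrightarrow> i \<in> {1..M} \<Longrightarrow>
    t i = (\<Union>j\<in>{1..M}. \<Union>q\<in>{..<ka l i j}. (\<lambda>y. th l *\<^sub>R y + ta l i j q) ` t j)"
  using rules unfolding subst_rules_def by blast

lemma compact_prototile: "i \<in> {1..M} \<Longrightarrow> compact (t i)"
  using rules unfolding subst_rules_def by blast

lemma prototiles_bounded: "\<exists>D. \<forall>j\<in>{1..M}. t j \<subseteq> cball 0 D"
proof -
  have "bounded (\<Union>j\<in>{1..M}. t j)"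
    using compact_prototile by (intro bounded_UN) (auto intro: compact_imp_bounded)
  then show ?thesis unfolding bounded_iff by (auto simp: subset_iff)
qed

lemma Theta_pos: "valid_seq N x \<Longrightarrow> 0 < Theta th x k"
  unfolding Theta_def valid_seq_def by (intro prod_pos) (auto intro!: th_pos)

lemma Theta_LIMSEQ_0:
  assumes x: "valid_seq N x"
  shows "Theta th x \<longlonglongrightarrow> 0"
proof -
  define q where "q = Max (th ` {1..N})"
  have "x 1 \<in> {1..N}" using x unfolding valid_seq_def by simp
  then have "q \<in> th ` {1..N}" unfolding q_def by (intro Max_in) auto
  then have q: "0 < q" "q < 1" using th_pos th_less_1 by auto
  have "Theta th x k \<le> q ^ k" for k
  proof -
    have "Theta th x k \<le> (\<Prod>n\<in>{1..k}. q)"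
      using x unfolding Theta_def valid_seq_def q_def
      by (intro prod_mono) (auto intro!: Max_ge less_imp_le[OF th_pos])
    then show ?thesis by simp
  qed
  moreover have "0 \<le> Theta th x k" for k using Theta_pos[OF x] less_imp_le by blast
  ultimately show ?thesis
    using q by (intro tendsto_sandwich[OF _ _ tendsto_const LIMSEQ_power_zero[of q]]) auto
qed

lemma supertile_Suc:
  "ST x (Suc k) i = (\<Union>j\<in>{1..M}. \<Union>q<ka (x (int (Suc k))) i j.
     translate_patch ((1 / Theta th x (Suc k)) *\<^sub>R ta (x (int (Suc k))) i j q) (ST x k j))"
  by (simp add: translate_patch_def)

lemma supertile_types: "i \<in> {1..M} \<Longrightarrow> p \<in> ST x k i \<Longrightarrow> fst p \<in> {1..M}"
proof (induction k arbitrary: i p)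
  case (Suc k)
  then obtain j w where "j \<in> {1..M}" "p \<in> translate_patch w (ST x k j)"
    unfolding supertile_Suc by blast
  then obtain p' where "p' \<in> ST x k j" "fst p = fst p'"
    unfolding translate_patch_def by (auto split: prod.splits)
  then show ?case using Suc.IH \<open>j \<in> {1..M}\<close> by simp
qed simp

lemma finite_supertile: "finite (ST x k i)"
  by (induction k arbitrary: i) (simp_all add: supertile_Suc finite_translate_patch)

lemma inflated_Suc:
  assumes x: "valid_seq N x" and i: "i \<in> {1..M}"
  shows "inflated x (Suc k) i = (\<Union>j\<in>{1..M}. \<Union>q<ka (x (int (Suc k))) i j.
            (+) ((1 / Theta th x (Suc k)) *\<^sub>R ta (x (int (Suc k))) i j q) ` inflated x k j)"
proof -
  let ?l = "x (int (Suc k))"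
  have l: "?l \<in> {1..N}" using x unfolding valid_seq_def by auto
  have scale: "(1 / Theta th x (Suc k)) * th ?l = 1 / Theta th x k"
    using Theta_pos[OF x] th_pos[OF l] by (simp add: Theta_Suc)
  have "(1 / Theta th x (Suc k)) *\<^sub>R (th ?l *\<^sub>R y + ta ?l i j q)
      = (1 / Theta th x (Suc k)) *\<^sub>R ta ?l i j q + (1 / Theta th x k) *\<^sub>R y" for y j q
    by (simp only: scaleR_add_right scaleR_scaleR scale add.commute)
  then have "(*\<^sub>R) (1 / Theta th x (Suc k)) ` (\<lambda>y. th ?l *\<^sub>R y + ta ?l i j q) ` t j
      = (+) ((1 / Theta th x (Suc k)) *\<^sub>R ta ?l i j q) ` inflated x k j" for j q
    unfolding image_image by (intro image_cong) simp_all
  then show ?thesis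
    by (subst prototile_eq_UN[OF l i]) (simp add: image_UN)
qed

lemma patch_support_supertile:
  assumes x: "valid_seq N x"
  shows "i \<in> {1..M} \<Longrightarrow> patch_support t (ST x k i) = inflated x k i"
proof (induction k arbitrary: i)
  case 0
  then show ?case by (simp add: patch_support_def tile_set_def)
next
  case (Suc k)
  then show ?case
    unfolding supertile_Suc patch_support_UN patch_support_translate_patch
      inflated_Suc[OF x Suc.prems]
    by (intro SUP_cong refl) simp
qed

section \<open>Towers of supertiles\<close>

definition is_piece :: "(int \<Rightarrow> nat) \<Rightarrow> nat \<Rightarrow> nat \<Rightarrow> nat \<Rightarrow> 'a \<Rightarrow> bool" where
  "is_piece x l a b d \<longleftrightarrow> a \<in> {1..M} \<and>
     (\<exists>q<ka (x (int (Suc l))) b a. d = (1 / Theta th x (Suc l)) *\<^sub>R ta (x (int (Suc l))) b a q)"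

text \<open>\<open>\<tau> l\<close> is the type of the level-l supertile and \<open>\<delta> l\<close> its position inside the
  level-(l+1) supertile.\<close>

definition tower :: "(int \<Rightarrow> nat) \<Rightarrow> nat \<Rightarrow> nat \<Rightarrow> (nat \<Rightarrow> nat) \<Rightarrow> (nat \<Rightarrow> 'a) \<Rightarrow> bool" where
  "tower x k n \<tau> \<delta> \<longleftrightarrow>
     (\<forall>l\<in>{k..n}. \<tau> l \<in> {1..M}) \<and> (\<forall>l\<in>{k..<n}. is_piece x l (\<tau> l) (\<tau> (Suc l)) (\<delta> l))"

lemma translate_patch_subset_if_is_piece:
  "is_piece x l a b d \<Longrightarrow> translate_patch d (ST x l a) \<subseteq> ST x (Suc l) b"
  unfolding is_piece_def supertile_Suc by blast

lemma tower_translate_patch_subset: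
  assumes "tower x k n \<tau> \<delta>" "k \<le> n"
  shows "translate_patch (sum \<delta> {k..<n}) (ST x k (\<tau> k)) \<subseteq> ST x n (\<tau> n)"
  using assms(2,1)
proof (induction n rule: dec_induct)
  case (step n)
  then have tower: "tower x k n \<tau> \<delta>" and piece: "is_piece x n (\<tau> n) (\<tau> (Suc n)) (\<delta> n)"
    unfolding tower_def by auto
  have "translate_patch (sum \<delta> {k..<Suc n}) (ST x k (\<tau> k))
      = translate_patch (\<delta> n) (translate_patch (sum \<delta> {k..<n}) (ST x k (\<tau> k)))"
    using step.hyps by (simp add: translate_patch_translate_patch)
  also have "\<dots> \<subseteq> translate_patch (\<delta> n) (ST x n (\<tau> n))"
    by (intro translate_patch_mono step.IH tower)
  also have "\<dots> \<subseteq> ST x (Suc n) (\<tau> (Suc n))"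
    by (rule translate_patch_subset_if_is_piece[OF piece])
  finally show ?case .
qed simp

lemma tower_inflated_subset:
  assumes x: "valid_seq N x" and "tower x k n \<tau> \<delta>" "k \<le> n"
  shows "(+) (sum \<delta> {k..<n}) ` inflated x k (\<tau> k) \<subseteq> inflated x n (\<tau> n)"
proof -
  have "\<tau> k \<in> {1..M}" "\<tau> n \<in> {1..M}" using assms(2,3) unfolding tower_def by auto
  then show ?thesis
    using patch_support_mono[OF tower_translate_patch_subset[OF assms(2,3)], of t]
    by (simp add: patch_support_translate_patch patch_support_supertile[OF x])
qed

lemma tower_snoc:
  assumes "tower x k n \<tau> \<delta>" "k \<le> n" "is_piece x n (\<tau> n) b d" "b \<in> {1..M}"
  shows "tower x k (Suc n) (\<tau>(Suc n := b)) (\<delta>(n := d))"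
  using assms unfolding tower_def by (auto simp: le_Suc_eq less_Suc_eq)

lemma tower_append:
  assumes "tower x k m \<tau>1 \<delta>1" "tower x m n \<tau>2 \<delta>2" "\<tau>1 m = \<tau>2 m"
  shows "tower x k n (\<lambda>l. if l < m then \<tau>1 l else \<tau>2 l) (\<lambda>l. if l < m then \<delta>1 l else \<delta>2 l)"
  unfolding tower_def
proof (intro conjI ballI)
  fix l assume "l \<in> {k..n}"
  then show "(if l < m then \<tau>1 l else \<tau>2 l) \<in> {1..M}"
    using assms unfolding tower_def by auto
next
  fix l assume l: "l \<in> {k..<n}"
  show "is_piece x l (if l < m then \<tau>1 l else \<tau>2 l) (if Suc l < m then \<tau>1 (Suc l) else \<tau>2 (Suc l))
      (if l < m then \<delta>1 l else \<delta>2 l)"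
  proof (cases "l < m")
    case True
    then have "(if Suc l < m then \<tau>1 (Suc l) else \<tau>2 (Suc l)) = \<tau>1 (Suc l)"
      using assms(3) by (cases "Suc l = m") auto
    then show ?thesis using True assms(1) l unfolding tower_def by auto
  next
    case False
    then show ?thesis using assms(2) l unfolding tower_def by auto
  qed
qed

text \<open>The product F^(x_n) \<dots> F^(x_(k+1)); its (i, j) entry counts the level-k supertiles of
  type j in the level-n supertile of type i.\<close>

definition level_product :: "(int \<Rightarrow> nat) \<Rightarrow> nat \<Rightarrow> nat \<Rightarrow> nat \<Rightarrow> nat \<Rightarrow> nat" where
  "level_product x k n = mprod M ka (map (\<lambda>l. x (int l)) (rev [Suc k..<Suc n]))"

lemma level_product_Suc:
  "k \<le> n \<Longrightarrow> level_product x k (Suc n) i j =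
    (\<Sum>m\<in>{1..M}. ka (x (int (Suc n))) i m * level_product x k n m j)"
  by (simp add: level_product_def)

lemma level_product_pos_Suc:
  assumes "k \<le> n" "0 < level_product x k (Suc n) i j"
  obtains m where "m \<in> {1..M}" "0 < ka (x (int (Suc n))) i m" "0 < level_product x k n m j"
proof -
  have "0 < (\<Sum>m\<in>{1..M}. ka (x (int (Suc n))) i m * level_product x k n m j)"
    using assms by (simp add: level_product_Suc)
  then obtain m where "m \<in> {1..M}" "0 < ka (x (int (Suc n))) i m * level_product x k n m j"
    by (metis (no_types, lifting) not_gr_zero sum.neutral)
  then show thesis using that by simp
qed

lemma tower_of_level_product_pos:
  assumes "k \<le> n" "a \<in> {1..M}" "b \<in> {1..M}" "0 < level_product x k n b a"
  shows "\<exists>\<tau> \<delta>. tower x k n \<tau> \<delta> \<and> \<tau> k = a \<and> \<tau> n = b"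
  using assms(1,3,4)
proof (induction n arbitrary: b rule: dec_induct)
  case base
  then have "a = b" by (simp add: level_product_def split: if_splits)
  then show ?case using assms(2) by (intro exI[of _ "\<lambda>_. a"]) (auto simp: tower_def)
next
  case (step n)
  obtain m where m: "m \<in> {1..M}" "0 < ka (x (int (Suc n))) b m" "0 < level_product x k n m a"
    using level_product_pos_Suc[OF step.hyps(1) step.prems(2)] .
  obtain \<tau> \<delta> where \<tau>: "tower x k n \<tau> \<delta>" "\<tau> k = a" "\<tau> n = m"
    using step.IH[OF m(1,3)] by blast
  define d where "d = (1 / Theta th x (Suc n)) *\<^sub>R ta (x (int (Suc n))) b m 0"
  have "is_piece x n (\<tau> n) b d"
    unfolding is_piece_def d_def using m \<tau>(3) by auto
  then have "tower x k (Suc n) (\<tau>(Suc n := b)) (\<delta>(n := d))"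
    by (rule tower_snoc[OF \<tau>(1) step.hyps(1) _ step.prems(1)])
  then show ?case
    using \<tau>(2) step.hyps(1) by (intro exI[of _ "\<tau>(Suc n := b)"] exI) auto
qed

lemma tower_through_point:
  assumes x: "valid_seq N x" and "k \<le> n" "j \<in> {1..M}" "c \<in> inflated x n j"
  shows "\<exists>\<tau> \<delta>. tower x k n \<tau> \<delta> \<and> \<tau> n = j \<and> c \<in> (+) (sum \<delta> {k..<n}) ` inflated x k (\<tau> k)"
  using assms(2-)
proof (induction n arbitrary: j c rule: dec_induct)
  case base
  then show ?case by (intro exI[of _ "\<lambda>_. j"]) (auto simp: tower_def)
next
  case (step n)
  obtain m q where m: "m \<in> {1..M}" and q: "q < ka (x (int (Suc n))) j m"
    and c: "c \<in> (+) ((1 / Theta th x (Suc n)) *\<^sub>R ta (x (int (Suc n))) j m q) ` inflated x n m"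
    using step.prems(2) unfolding inflated_Suc[OF x step.prems(1)] by blast
  define d where "d = (1 / Theta th x (Suc n)) *\<^sub>R ta (x (int (Suc n))) j m q"
  obtain c' where c': "c' \<in> inflated x n m" "c = d + c'"
    using c unfolding d_def by blast
  obtain \<tau> \<delta> where \<tau>: "tower x k n \<tau> \<delta>" "\<tau> n = m" "c' \<in> (+) (sum \<delta> {k..<n}) ` inflated x k (\<tau> k)"
    using step.IH[OF m c'(1)] by blast
  have "is_piece x n m j d" unfolding is_piece_def d_def using m q by auto
  then have "tower x k (Suc n) (\<tau>(Suc n := j)) (\<delta>(n := d))"
    using tower_snoc[OF \<tau>(1) step.hyps(1)] \<tau>(2) step.prems(1) by simp
  moreover have "sum (\<delta>(n := d)) {k..<Suc n} = sum \<delta> {k..<n} + d"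
    using step.hyps by simp
  ultimately show ?case
    using \<tau>(3) c'(2) step.hyps
    by (intro exI[of _ "\<tau>(Suc n := j)"] exI[of _ "\<delta>(n := d)"]) (force simp: add_ac)
qed

lemma level_product_eq_prod_seg:
  "prod_seg M ka x (int n) (int (Suc k)) = level_product x k n"
proof -
  have "filter (\<lambda>k. k \<noteq> 0) (rev [int (Suc k)..int n]) = map int (rev [Suc k..<Suc n])"
    unfolding upto_of_nat rev_map by (auto simp: filter_map o_def intro!: filter_True)
  then show ?thesis unfolding prod_seg_def level_product_def by (simp add: o_def)
qed

definition minimal_seq :: "(int \<Rightarrow> nat) \<Rightarrow> bool" where
  "minimal_seq x \<longleftrightarrow> (\<forall>k. \<exists>n>k. \<forall>i\<in>{1..M}. \<forall>j\<in>{1..M}. 0 < level_product x k n i j)"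

lemma minimal_seqI:
  assumes "\<forall>m. m \<noteq> 0 \<longrightarrow>
    (\<exists>n. n \<noteq> 0 \<and> n > m \<and> (\<forall>i\<in>{1..M}. \<forall>j\<in>{1..M}. prod_seg M ka x n m i j > 0))"
  shows "minimal_seq x"
  unfolding minimal_seq_def
proof
  fix k
  obtain n where "n > int (Suc k)" "\<forall>i\<in>{1..M}. \<forall>j\<in>{1..M}. prod_seg M ka x n (int (Suc k)) i j > 0"
    using assms by (metis of_nat_Suc of_nat_neq_0)
  then show "\<exists>n>k. \<forall>i\<in>{1..M}. \<forall>j\<in>{1..M}. 0 < level_product x k n i j"
    by (intro exI[of _ "nat n"]) (auto simp flip: level_product_eq_prod_seg)
qed

section \<open>Tilings\<close>

lemma tower_concat:
  fixes \<tau>s :: "nat \<Rightarrow> nat \<Rightarrow> nat" and \<delta>s :: "nat \<Rightarrow> nat \<Rightarrow> 'a"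
  assumes K: "strict_mono K" "K 0 = 0"
    and towers: "\<And>m. tower x (K m) (K (Suc m)) (\<tau>s m) (\<delta>s m)"
    and match: "\<And>m. \<tau>s (Suc m) (K (Suc m)) = \<tau>s m (K (Suc m))"
  obtains \<tau> \<delta> where "\<And>n. tower x 0 n \<tau> \<delta>"
    and "\<And>m l. K m \<le> l \<Longrightarrow> l < K (Suc m) \<Longrightarrow> \<tau> l = \<tau>s m l \<and> \<delta> l = \<delta>s m l"
proof -
  define seg where "seg l = (THE m. K m \<le> l \<and> l < K (Suc m))" for l
  have seg: "K (seg l) \<le> l \<and> l < K (Suc (seg l))" for l
    unfolding seg_def by (rule theI'[OF strict_mono_segment[OF K]])
  have seg_eq: "seg l = m" if "K m \<le> l" "l < K (Suc m)" for l m
    unfolding seg_def using that by (intro the1_equality[OF strict_mono_segment[OF K]]) auto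
  define \<tau> where "\<tau> l = \<tau>s (seg l) l" for l
  define \<delta> where "\<delta> l = \<delta>s (seg l) l" for l
  have agree: "\<tau> l = \<tau>s m l \<and> \<delta> l = \<delta>s m l" if "K m \<le> l" "l < K (Suc m)" for m l
    using seg_eq[OF that] unfolding \<tau>_def \<delta>_def by simp
  have "tower x 0 n \<tau> \<delta>" for n
    unfolding tower_def
  proof (intro conjI ballI)
    fix l
    show "\<tau> l \<in> {1..M}"
      using towers[of "seg l"] seg[of l] unfolding \<tau>_def tower_def by auto
    let ?m = "seg l"
    have piece: "is_piece x l (\<tau>s ?m l) (\<tau>s ?m (Suc l)) (\<delta>s ?m l)"
      using towers[of ?m] seg[of l] unfolding tower_def by auto
    have "\<tau> (Suc l) = \<tau>s ?m (Suc l)"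
    proof (cases "Suc l < K (Suc ?m)")
      case True
      then show ?thesis using agree seg[of l] by simp
    next
      case False
      then have "Suc l = K (Suc ?m)" using seg[of l] by simp
      moreover have "K (Suc ?m) < K (Suc (Suc ?m))" using K(1) by (simp add: strict_mono_less)
      ultimately show ?thesis using agree[of "Suc ?m" "Suc l"] match[of ?m] by simp
    qed
    then show "is_piece x l (\<tau> l) (\<tau> (Suc l)) (\<delta> l)"
      using piece unfolding \<tau>_def \<delta>_def by simp
  qed
  then show thesis using that agree by blast
qed

lemma tower_tiling_in_Omega:
  assumes x: "valid_seq N x" and towers: "\<And>n. tower x 0 n \<tau> \<delta>"
    and cover: "(\<Union>l. (+) (- sum \<delta> {0..<l}) ` inflated x l (\<tau> l)) = UNIV"
  shows "(\<Union>l. translate_patch (- sum \<delta> {0..<l}) (ST x l (\<tau> l))) \<in> Omega M t th ka ta x"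
proof -
  define w where "w l = - sum \<delta> {0..<l}" for l
  have types: "\<tau> l \<in> {1..M}" for l
    using towers[of l] unfolding tower_def by auto
  have nested: "translate_patch (w l) (ST x l (\<tau> l))
      \<subseteq> translate_patch (w (Suc l)) (ST x (Suc l) (\<tau> (Suc l)))" for l
  proof -
    have "is_piece x l (\<tau> l) (\<tau> (Suc l)) (\<delta> l)"
      using towers[of "Suc l"] unfolding tower_def by auto
    moreover have "w l = \<delta> l + w (Suc l)" unfolding w_def by simp
    ultimately show ?thesis
      using translate_patch_mono[OF translate_patch_subset_if_is_piece, of x l "\<tau> l" "\<tau> (Suc l)"
          "\<delta> l" "w (Suc l)"]
      by (simp add: translate_patch_translate_patch)
  qed
  have "patch_support t (\<Union>l. translate_patch (w l) (ST x l (\<tau> l))) = UNIV"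
    using cover
    by (simp add: w_def patch_support_UN patch_support_translate_patch
        patch_support_supertile[OF x types])
  then show ?thesis
    unfolding Omega_def mem_Collect_eq patch_support_def w_def[symmetric]
    using types nested by blast
qed

lemma dist_le_in_inflated:
  assumes x: "valid_seq N x" and D: "\<forall>j\<in>{1..M}. t j \<subseteq> cball 0 D" and j: "j \<in> {1..M}"
    and y: "y \<in> (+) w ` inflated x k j" and z: "z \<in> (+) w ` inflated x k j"
  shows "dist y z \<le> 2 * D / Theta th x k"
proof -
  obtain a b where ab: "a \<in> t j" "b \<in> t j"
    and yz: "y = w + (1 / Theta th x k) *\<^sub>R a" "z = w + (1 / Theta th x k) *\<^sub>R b"
    using y z by blast
  have "norm a \<le> D" "norm b \<le> D" using D j ab by (auto simp: subset_iff)
  then have "norm (a - b) \<le> 2 * D" using norm_triangle_ineq4[of a b] by linarith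
  moreover have "dist y z = norm (a - b) / Theta th x k"
    using Theta_pos[OF x, of k] unfolding yz dist_norm
    by (simp add: abs_of_pos flip: scaleR_diff_right)
  ultimately show ?thesis
    using divide_right_mono[of "norm (a - b)" "2 * D" "Theta th x k"] Theta_pos[OF x, of k] by simp
qed

lemma cball_subset_inflated:
  assumes x: "valid_seq N x" and D: "\<forall>j\<in>{1..M}. t j \<subseteq> cball 0 D" and j: "j \<in> {1..M}"
    and ball: "cball a \<epsilon> \<subseteq> t j0"
    and c: "(1 / Theta th x n) *\<^sub>R a \<in> (+) w ` inflated x k j" and y: "y \<in> (+) w ` inflated x k j"
    and small: "R + 2 * D / Theta th x k \<le> \<epsilon> / Theta th x n"
  shows "cball y R \<subseteq> inflated x n j0"
proof -
  let ?c = "(1 / Theta th x n) *\<^sub>R a"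
  have "cball y R \<subseteq> cball ?c (\<epsilon> / Theta th x n)"
  proof
    fix p assume "p \<in> cball y R"
    then have "dist ?c p \<le> dist ?c y + R" using dist_triangle[of ?c p y] by simp
    then show "p \<in> cball ?c (\<epsilon> / Theta th x n)"
      using dist_le_in_inflated[OF x D j c y] small by simp
  qed
  also have "\<dots> = (*\<^sub>R) (1 / Theta th x n) ` cball a \<epsilon>"
    using cball_scale[of "1 / Theta th x n" a \<epsilon>] Theta_pos[OF x, of n] by simp
  also have "\<dots> \<subseteq> inflated x n j0"
    using ball by (rule image_mono)
  finally show ?thesis .
qed

lemma Theta_eventually_less:
  assumes "valid_seq N x" "0 < \<epsilon>"
  obtains n where "k \<le> n" "Theta th x n * C < \<epsilon>"
proof -
  have "(\<lambda>n. Theta th x n * C) \<longlonglongrightarrow> 0"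
    using tendsto_mult_left_zero[OF Theta_LIMSEQ_0[OF assms(1)]] .
  from order_tendstoD(2)[OF this assms(2)] obtain n0 where "\<forall>n\<ge>n0. Theta th x n * C < \<epsilon>"
    unfolding eventually_sequentially by blast
  then show thesis using that[of "max n0 k"] by simp
qed

text \<open>Go up from level k to a level k' from which all types are reachable, and then to a level n
  so high that the blown-up ball \<open>cball a \<epsilon>\<close>, of radius \<open>\<epsilon> / Theta th x n\<close>, exceeds R plus the
  diameter of the level-k' supertiles.\<close>

lemma deep_tower_exists:
  assumes x: "valid_seq N x" "minimal_seq x" and j0: "j0 \<in> {1..M}"
    and \<epsilon>: "0 < \<epsilon>" "cball a \<epsilon> \<subseteq> t j0" and i: "i \<in> {1..M}"
  shows "\<exists>n \<tau> \<delta>. k < n \<and> tower x k n \<tau> \<delta> \<and> \<tau> k = i \<and> \<tau> n = j0 \<and>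
           (\<forall>z \<in> inflated x k i. cball (sum \<delta> {k..<n} + z) R \<subseteq> inflated x n j0)"
proof -
  obtain D where D: "\<forall>j\<in>{1..M}. t j \<subseteq> cball 0 D"
    using prototiles_bounded by blast
  obtain k' where k': "k < k'" "\<forall>i\<in>{1..M}. \<forall>j\<in>{1..M}. 0 < level_product x k k' i j"
    using x(2) unfolding minimal_seq_def by blast
  obtain n where n: "k' \<le> n" "Theta th x n * (R + 2 * D / Theta th x k') < \<epsilon>"
    using Theta_eventually_less[OF x(1) \<epsilon>(1)] .
  then have small: "R + 2 * D / Theta th x k' \<le> \<epsilon> / Theta th x n"
    using Theta_pos[OF x(1), of n] by (simp add: le_divide_eq mult.commute)
  have "a \<in> t j0" using \<epsilon> by (auto simp: subset_iff)
  then obtain \<tau>2 \<delta>2 where \<tau>2: "tower x k' n \<tau>2 \<delta>2" "\<tau>2 n = j0"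
    and c: "(1 / Theta th x n) *\<^sub>R a \<in> (+) (sum \<delta>2 {k'..<n}) ` inflated x k' (\<tau>2 k')"
    using tower_through_point[OF x(1) n(1) j0] by blast
  have i': "\<tau>2 k' \<in> {1..M}" using \<tau>2(1) n(1) unfolding tower_def by auto
  obtain \<tau>1 \<delta>1 where \<tau>1: "tower x k k' \<tau>1 \<delta>1" "\<tau>1 k = i" "\<tau>1 k' = \<tau>2 k'"
    using tower_of_level_product_pos[OF less_imp_le[OF k'(1)] i i' k'(2)[rule_format, OF i' i]]
    by blast
  define \<tau> where "\<tau> l = (if l < k' then \<tau>1 l else \<tau>2 l)" for l
  define \<delta> where "\<delta> l = (if l < k' then \<delta>1 l else \<delta>2 l)" for l
  have tower: "tower x k n \<tau> \<delta>"
    unfolding \<tau>_def[abs_def] \<delta>_def[abs_def] by (rule tower_append[OF \<tau>1(1) \<tau>2(1) \<tau>1(3)])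
  have sum: "sum \<delta> {k..<n} = sum \<delta>1 {k..<k'} + sum \<delta>2 {k'..<n}"
    unfolding \<delta>_def using k'(1) n(1) by (intro sum_atLeastLessThan_if_less) auto
  have "cball (sum \<delta> {k..<n} + z) R \<subseteq> inflated x n j0" if z: "z \<in> inflated x k i" for z
  proof (rule cball_subset_inflated[OF x(1) D i' \<epsilon>(2) c _ small])
    have "sum \<delta>1 {k..<k'} + z \<in> inflated x k' (\<tau>2 k')"
      using tower_inflated_subset[OF x(1) \<tau>1(1) less_imp_le[OF k'(1)]] z unfolding \<tau>1(2,3) by blast
    moreover have "sum \<delta> {k..<n} + z = sum \<delta>2 {k'..<n} + (sum \<delta>1 {k..<k'} + z)"
      unfolding sum by (simp add: algebra_simps)
    ultimately show "sum \<delta> {k..<n} + z \<in> (+) (sum \<delta>2 {k'..<n}) ` inflated x k' (\<tau>2 k')"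
      by (simp only: image_eqI)
  qed
  then show ?thesis
    using k'(1) n(1) tower \<tau>1(2) \<tau>2(2)
    by (intro exI[of _ n] exI[of _ \<tau>] exI[of _ \<delta>]) (simp add: \<tau>_def)
qed

lemma infinite_deep_tower_exists:
  assumes x: "valid_seq N x" "minimal_seq x" and j0: "j0 \<in> {1..M}"
    and \<epsilon>: "0 < \<epsilon>" "cball a \<epsilon> \<subseteq> t j0"
  obtains K \<tau> \<delta> where "strict_mono K" "\<And>n. tower x 0 n \<tau> \<delta>" "\<And>m. \<tau> (K m) = j0"
    "\<And>m z. z \<in> inflated x (K m) j0 \<Longrightarrow>
       cball (sum \<delta> {K m..<K (Suc m)} + z) (real m) \<subseteq> inflated x (K (Suc m)) j0"
proof -
  obtain nxt \<tau>s \<delta>s where seg: "\<And>k R. k < nxt k R \<and> tower x k (nxt k R) (\<tau>s k R) (\<delta>s k R) \<and>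
      \<tau>s k R k = j0 \<and> \<tau>s k R (nxt k R) = j0 \<and>
      (\<forall>z \<in> inflated x k j0. cball (sum (\<delta>s k R) {k..<nxt k R} + z) R \<subseteq> inflated x (nxt k R) j0)"
    using deep_tower_exists[OF x j0 \<epsilon> j0] by metis
  define K where "K = rec_nat 0 (\<lambda>m k. nxt k (real m))"
  have K_Suc: "K (Suc m) = nxt (K m) (real m)" for m unfolding K_def by simp
  have K: "strict_mono K" "K 0 = 0"
    using seg by (simp_all add: strict_mono_Suc_iff K_Suc, simp add: K_def)
  define \<tau>m where "\<tau>m m = \<tau>s (K m) (real m)" for m
  define \<delta>m where "\<delta>m m = \<delta>s (K m) (real m)" for m
  have "tower x (K m) (K (Suc m)) (\<tau>m m) (\<delta>m m)" "\<tau>m (Suc m) (K (Suc m)) = \<tau>m m (K (Suc m))" for m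
    using seg unfolding \<tau>m_def \<delta>m_def K_Suc by auto
  then obtain \<tau> \<delta> where towers: "\<And>n. tower x 0 n \<tau> \<delta>"
    and agree: "\<And>m l. K m \<le> l \<Longrightarrow> l < K (Suc m) \<Longrightarrow> \<tau> l = \<tau>m m l \<and> \<delta> l = \<delta>m m l"
    by (rule tower_concat[OF K]) blast
  have "\<tau> (K m) = j0" for m
    using agree[of m "K m"] seg K(1) unfolding \<tau>m_def by (simp add: K_Suc strict_mono_less)
  moreover have "sum \<delta> {K m..<K (Suc m)} = sum (\<delta>m m) {K m..<K (Suc m)}" for m
    using agree by (intro sum.cong) simp_all
  ultimately show thesis
    using that[OF K(1) towers] seg unfolding \<delta>m_def K_Suc by simp
qed

text \<open>Nested supertiles whose supports contain balls of radii 0, 1, 2, \<dots> around a common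
  point form a tiling of the whole space.\<close>

lemma Omega_nonempty:
  assumes x: "valid_seq N x" "minimal_seq x" and j0: "j0 \<in> {1..M}" "interior (t j0) \<noteq> {}"
  shows "Omega M t th ka ta x \<noteq> {}"
proof -
  obtain a \<epsilon> where \<epsilon>: "0 < \<epsilon>" "cball a \<epsilon> \<subseteq> t j0"
    using j0(2) by (metis all_not_in_conv mem_interior_cball)
  obtain K \<tau> \<delta> where K: "strict_mono K" and towers: "\<And>n. tower x 0 n \<tau> \<delta>" and \<tau>K: "\<And>m. \<tau> (K m) = j0"
    and deep: "\<And>m z. z \<in> inflated x (K m) j0 \<Longrightarrow>
       cball (sum \<delta> {K m..<K (Suc m)} + z) (real m) \<subseteq> inflated x (K (Suc m)) j0"
    using infinite_deep_tower_exists[OF x j0(1) \<epsilon>] by blast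
  define S where "S l = (+) (- sum \<delta> {0..<l}) ` inflated x l (\<tau> l)" for l
  have "(\<Union>m. S (K m)) = UNIV"
  proof (rule UN_eq_UNIV_if_cball_step)
    have "a \<in> t j0" using \<epsilon> by (auto simp: subset_iff)
    then show "- sum \<delta> {0..<K 0} + (1 / Theta th x (K 0)) *\<^sub>R a \<in> S (K 0)"
      unfolding S_def \<tau>K by (intro imageI) simp
    fix m y assume "y \<in> S (K m)"
    then obtain z where y: "y = - sum \<delta> {0..<K m} + z" and z: "z \<in> inflated x (K m) j0"
      unfolding S_def \<tau>K by (rule imageE)
    have "K m \<le> K (Suc m)" using K by (simp add: strict_mono_less_eq)
    then have "sum \<delta> {0..<K (Suc m)} = sum \<delta> {0..<K m} + sum \<delta> {K m..<K (Suc m)}"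
      by (intro sum.atLeastLessThan_concat[symmetric]) simp_all
    then have "cball y (real m)
        = (+) (- sum \<delta> {0..<K (Suc m)}) ` cball (sum \<delta> {K m..<K (Suc m)} + z) (real m)"
      unfolding y cball_translation[symmetric] by (simp add: algebra_simps)
    also have "\<dots> \<subseteq> S (K (Suc m))"
      unfolding S_def \<tau>K using deep[OF z] by (rule image_mono)
    finally show "cball y (real m) \<subseteq> S (K (Suc m))" .
  qed
  then have "(\<Union>l. S l) = UNIV" by blast
  then show ?thesis
    using tower_tiling_in_Omega[OF x(1) towers] unfolding S_def by blast
qed

lemma Omega_empty_if_interiors_empty:
  assumes "\<forall>j\<in>{1..M}. interior (t j) = {}"
  shows "Omega M t th ka ta x = {}"
proof (rule ccontr)
  assume "Omega M t th ka ta x \<noteq> {}"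
  then obtain \<tau> w where \<tau>: "\<forall>k. \<tau> k \<in> {1..M}"
    and cover: "patch_support t (\<Union>k. translate_patch (w k) (ST x k (\<tau> k))) = UNIV"
    unfolding Omega_def patch_support_def by blast
  define T where "T = (\<Union>k. translate_patch (w k) (ST x k (\<tau> k)))"
  have "countable T"
    unfolding T_def
    by (rule countable_UN) (simp_all add: countable_finite finite_translate_patch finite_supertile)
  moreover have "closed (tile_set t p) \<and> interior (tile_set t p) = {}" if "p \<in> T" for p
  proof -
    obtain j v where p: "p = (j, v)" by fastforce
    from that obtain k where "(j, v - w k) \<in> ST x k (\<tau> k)"
      unfolding T_def p by (auto simp: mem_translate_patch)
    from supertile_types[OF \<tau>[rule_format] this] have j: "j \<in> {1..M}" by simp
    have "tile_set t p = (+) v ` t j" unfolding p tile_set_def by simp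
    then show ?thesis
      using compact_imp_closed[OF compact_translation[OF compact_prototile[OF j]]] assms j
      by (simp add: interior_translation)
  qed
  ultimately have "\<Union>(tile_set t ` T) \<noteq> UNIV"
    by (intro Baire_UN_neq_UNIV) auto
  then show False using cover unfolding patch_support_def T_def by simp
qed

lemma prototiles_nonempty:
  assumes x: "valid_seq N x" "minimal_seq x" and j0: "j0 \<in> {1..M}" "t j0 \<noteq> {}"
    and j: "j \<in> {1..M}"
  shows "t j \<noteq> {}"
proof -
  obtain n where "0 < n" "0 < level_product x 0 n j j0"
    using x(2) j j0 unfolding minimal_seq_def by blast
  then obtain \<tau> \<delta> where "tower x 0 n \<tau> \<delta>" "\<tau> 0 = j0" "\<tau> n = j"
    using tower_of_level_product_pos[of 0 n j0 j] j j0 by blast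
  then have "(+) (sum \<delta> {0..<n}) ` inflated x 0 j0 \<subseteq> inflated x n j"
    using tower_inflated_subset[OF x(1)] by fastforce
  then show ?thesis using j0(2) by auto
qed

definition supertile_returns :: "(int \<Rightarrow> nat) \<Rightarrow> 'a set" where
  "supertile_returns x = (\<Union>k. \<Union>i\<in>{1..M}. return_vectors (ST x k i))"

lemma return_vectors_Omega_subset:
  assumes "T \<in> Omega M t th ka ta x"
  shows "return_vectors T \<subseteq> supertile_returns x"
proof
  fix u assume u: "u \<in> return_vectors T"
  obtain \<tau> w where \<tau>: "\<forall>k. \<tau> k \<in> {1..M}"
    and nested: "\<forall>k. translate_patch (w k) (ST x k (\<tau> k))
       \<subseteq> translate_patch (w (Suc k)) (ST x (Suc k) (\<tau> (Suc k)))"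
    and T_eq: "T = (\<Union>k. translate_patch (w k) (ST x k (\<tau> k)))"
    using assms unfolding Omega_def by blast
  define P where "P k = translate_patch (w k) (ST x k (\<tau> k))" for k
  have "incseq P" using nested unfolding P_def by (intro incseq_SucI) blast
  obtain j v k1 k2 where "(j, v) \<in> P k1" "(j, v + u) \<in> P k2"
    using u unfolding return_vectors_def T_eq P_def by blast
  moreover have "P k1 \<subseteq> P (max k1 k2)" "P k2 \<subseteq> P (max k1 k2)"
    using incseqD[OF \<open>incseq P\<close>] by simp_all
  ultimately have "u \<in> return_vectors (P (max k1 k2))"
    unfolding return_vectors_def by blast
  then show "u \<in> supertile_returns x"
    unfolding P_def return_vectors_translate_patch supertile_returns_def using \<tau> by blast
qed

text \<open>By minimality every supertile occurs inside every supertile of a high enough level.\<close>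

lemma supertile_returns_subset_Omega:
  assumes x: "minimal_seq x" and T: "T \<in> Omega M t th ka ta x"
  shows "supertile_returns x \<subseteq> return_vectors T"
proof
  fix u assume "u \<in> supertile_returns x"
  then obtain k i where i: "i \<in> {1..M}" and u: "u \<in> return_vectors (ST x k i)"
    unfolding supertile_returns_def by blast
  obtain \<tau> w where \<tau>: "\<forall>k. \<tau> k \<in> {1..M}"
    and T_eq: "T = (\<Union>k. translate_patch (w k) (ST x k (\<tau> k)))"
    using T unfolding Omega_def by blast
  obtain n where n: "k < n" "\<forall>i\<in>{1..M}. \<forall>j\<in>{1..M}. 0 < level_product x k n i j"
    using x unfolding minimal_seq_def by blast
  then obtain \<sigma> \<delta> where \<sigma>: "tower x k n \<sigma> \<delta>" "\<sigma> k = i" "\<sigma> n = \<tau> n"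
    using tower_of_level_product_pos[OF less_imp_le[OF n(1)] i \<tau>[rule_format, of n]] i \<tau> by blast
  have "translate_patch (sum \<delta> {k..<n}) (ST x k i) \<subseteq> ST x n (\<tau> n)"
    using tower_translate_patch_subset[OF \<sigma>(1)] n(1) \<sigma>(2,3) by simp
  then have "translate_patch (w n) (translate_patch (sum \<delta> {k..<n}) (ST x k i))
      \<subseteq> translate_patch (w n) (ST x n (\<tau> n))"
    by (rule translate_patch_mono)
  also have "\<dots> \<subseteq> T" unfolding T_eq by blast
  finally have "return_vectors (translate_patch (w n) (translate_patch (sum \<delta> {k..<n}) (ST x k i)))
      \<subseteq> return_vectors T"
    by (rule return_vectors_mono)
  then show "u \<in> return_vectors T"
    using u unfolding return_vectors_translate_patch by blast
qed

lemma Lambda_eq_supertile_returns: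
  "minimal_seq x \<Longrightarrow> Omega M t th ka ta x \<noteq> {} \<Longrightarrow> Lambda M t th ka ta x = supertile_returns x"
  unfolding Lambda_eq_UN_return_vectors
  by (auto dest: return_vectors_Omega_subset supertile_returns_subset_Omega)

section \<open>The rank along the shift\<close>

definition supertile_rank :: "(int \<Rightarrow> nat) \<Rightarrow> enat" where
  "supertile_rank x = group_rank (int_span (supertile_returns x))"

lemma rank_x_eq_supertile_rank:
  assumes "valid_seq N x" "minimal_seq x" "j0 \<in> {1..M}" "interior (t j0) \<noteq> {}"
  shows "rank_x M t th ka ta x = supertile_rank x"
  unfolding rank_x_def supertile_rank_def
  using Lambda_eq_supertile_returns[OF assms(2) Omega_nonempty[OF assms]] by simp

lemma supertile_cong:
  "(\<And>l. l \<in> {1..k} \<Longrightarrow> x (int l) = y (int l)) \<Longrightarrow> ST x k i = ST y k i"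
proof (induction k arbitrary: i)
  case (Suc k)
  have "ST x k j = ST y k j" for j using Suc by simp
  moreover have "Theta th x (Suc k) = Theta th y (Suc k)" using Suc.prems by (rule Theta_cong)
  moreover have "x (int (Suc k)) = y (int (Suc k))" using Suc.prems[of "Suc k"] by simp
  ultimately show ?case by (simp only: supertile.simps)
qed simp

definition supertile_returns_upto :: "(int \<Rightarrow> nat) \<Rightarrow> nat \<Rightarrow> 'a set" where
  "supertile_returns_upto x K = (\<Union>k\<le>K. \<Union>i\<in>{1..M}. return_vectors (ST x k i))"

lemma enat_le_supertile_rank_iff:
  "enat c \<le> supertile_rank x \<longleftrightarrow>
    (\<exists>K S. finite S \<and> S \<subseteq> int_span (supertile_returns_upto x K) \<and> int_indep S \<and> c \<le> card S)"
proof -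
  have returns: "supertile_returns x = (\<Union>K. supertile_returns_upto x K)"
    unfolding supertile_returns_def supertile_returns_upto_def by blast
  have "incseq (supertile_returns_upto x)"
    unfolding incseq_def supertile_returns_upto_def by fastforce
  have span_iff:
    "S \<subseteq> int_span (supertile_returns x) \<longleftrightarrow> (\<exists>K. S \<subseteq> int_span (supertile_returns_upto x K))"
    if "finite S" for S
  proof
    assume "S \<subseteq> int_span (supertile_returns x)"
    then show "\<exists>K. S \<subseteq> int_span (supertile_returns_upto x K)"
      unfolding returns by (rule int_span_UN_incseq[OF that _ \<open>incseq (supertile_returns_upto x)\<close>])
  next
    assume "\<exists>K. S \<subseteq> int_span (supertile_returns_upto x K)"
    then obtain K where "S \<subseteq> int_span (supertile_returns_upto x K)" ..
    moreover have "int_span (supertile_returns_upto x K) \<subseteq> int_span (supertile_returns x)"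
      unfolding returns by (intro int_span_mono) (rule UN_upper, simp)
    ultimately show "S \<subseteq> int_span (supertile_returns x)" by (rule order.trans)
  qed
  show ?thesis
    unfolding supertile_rank_def enat_le_group_rank_iff using span_iff by meson
qed

lemma supertile_rank_level_set_sets:
  "{x \<in> space (SigmaM N). enat c \<le> supertile_rank x} \<in> sets (SigmaM N)"
proof -
  have "{x \<in> space (SigmaM N). enat c \<le> supertile_rank x} = (\<Union>K. {x \<in> space (SigmaM N).
      \<exists>S. finite S \<and> S \<subseteq> int_span (supertile_returns_upto x K) \<and> int_indep S \<and> c \<le> card S})"
    unfolding enat_le_supertile_rank_iff by auto
  also have "\<dots> \<in> sets (SigmaM N)"
  proof (intro sets.countable_UN'' sets_SigmaM_if_depends_on_initial)
    fix K and x y :: "int \<Rightarrow> nat"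
    assume "\<forall>l\<in>{1..K}. x (int l) = y (int l)"
    then have "ST x k i = ST y k i" if "k \<le> K" for k i
      using that by (intro supertile_cong) auto
    then have "supertile_returns_upto x K = supertile_returns_upto y K"
      unfolding supertile_returns_upto_def by (intro SUP_cong refl) simp
    then show "(\<exists>S. finite S \<and> S \<subseteq> int_span (supertile_returns_upto x K) \<and> int_indep S \<and> c \<le> card S)
      \<longleftrightarrow> (\<exists>S. finite S \<and> S \<subseteq> int_span (supertile_returns_upto y K) \<and> int_indep S \<and> c \<le> card S)"
      by simp
  qed simp
  finally show ?thesis .
qed

lemma supertile_shiftS:
  "(j, v) \<in> ST (shiftS x) k i \<Longrightarrow> (j', w) \<in> ST x 1 j \<Longrightarrow>
    (j', w + (1 / th (x 1)) *\<^sub>R v) \<in> ST x (Suc k) i"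
proof (induction k arbitrary: i v)
  case (Suc k)
  let ?l = "x (int (Suc (Suc k)))"
  from Suc.prems(1) obtain j1 q where j1: "j1 \<in> {1..M}" "q < ka ?l i j1"
    and v0: "(j, v - (1 / Theta th (shiftS x) (Suc k)) *\<^sub>R ta ?l i j1 q) \<in> ST (shiftS x) k j1"
    unfolding supertile_Suc[of "shiftS x"] shiftS_Suc by (auto simp: mem_translate_patch)
  have "1 / Theta th x (Suc (Suc k)) = (1 / th (x 1)) * (1 / Theta th (shiftS x) (Suc k))"
    unfolding Theta_Suc_shiftS[of th x "Suc k"] by simp
  then have "w + (1 / th (x 1)) *\<^sub>R v - (1 / Theta th x (Suc (Suc k))) *\<^sub>R ta ?l i j1 q
      = w + (1 / th (x 1)) *\<^sub>R (v - (1 / Theta th (shiftS x) (Suc k)) *\<^sub>R ta ?l i j1 q)"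
    by (simp add: scaleR_diff_right)
  then have "(j', w + (1 / th (x 1)) *\<^sub>R v)
      \<in> translate_patch ((1 / Theta th x (Suc (Suc k))) *\<^sub>R ta ?l i j1 q) (ST x (Suc k) j1)"
    unfolding mem_translate_patch using Suc.IH[OF v0 Suc.prems(2)] by (simp only:)
  then show ?case
    unfolding supertile_Suc[of x "Suc k"] using j1 by blast
qed simp

lemma supertile_1_nonempty:
  assumes x: "valid_seq N x" and nonempty: "\<forall>j\<in>{1..M}. t j \<noteq> {}" and j: "j \<in> {1..M}"
  shows "ST x 1 j \<noteq> {}"
proof -
  have "x 1 \<in> {1..N}" using x unfolding valid_seq_def by auto
  then obtain j' q where "j' \<in> {1..M}" "q < ka (x 1) j j'"
    using prototile_eq_UN[of "x 1" j] nonempty j by fastforce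
  then show ?thesis
    by (auto simp: supertile_Suc[of x 0] translate_patch_def)
qed

lemma supertile_returns_shiftS:
  assumes x: "valid_seq N x" and nonempty: "\<forall>j\<in>{1..M}. t j \<noteq> {}"
  shows "(*\<^sub>R) (1 / th (x 1)) ` supertile_returns (shiftS x) \<subseteq> supertile_returns x"
proof
  fix z assume "z \<in> (*\<^sub>R) (1 / th (x 1)) ` supertile_returns (shiftS x)"
  then obtain u k i where i: "i \<in> {1..M}" and u: "u \<in> return_vectors (ST (shiftS x) k i)"
    and z: "z = (1 / th (x 1)) *\<^sub>R u"
    unfolding supertile_returns_def by blast
  from u obtain j v where p1: "(j, v) \<in> ST (shiftS x) k i" and p2: "(j, v + u) \<in> ST (shiftS x) k i"
    unfolding return_vectors_def by blast
  have "j \<in> {1..M}" using supertile_types[OF i p1] by simp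
  then obtain j' w where jw: "(j', w) \<in> ST x 1 j"
    using supertile_1_nonempty[OF x nonempty] by fast
  have "(j', w + (1 / th (x 1)) *\<^sub>R v) \<in> ST x (Suc k) i"
    "(j', (w + (1 / th (x 1)) *\<^sub>R v) + z) \<in> ST x (Suc k) i"
    using supertile_shiftS[OF p1 jw] supertile_shiftS[OF p2 jw]
    unfolding z by (simp_all add: scaleR_add_right add.assoc)
  then show "z \<in> supertile_returns x"
    unfolding supertile_returns_def return_vectors_def using i by blast
qed

lemma supertile_rank_shiftS_le:
  assumes x: "valid_seq N x" and nonempty: "\<forall>j\<in>{1..M}. t j \<noteq> {}"
  shows "supertile_rank (shiftS x) \<le> supertile_rank x"
proof -
  have "x 1 \<in> {1..N}" using x unfolding valid_seq_def by auto
  then have "0 < th (x 1)" by (rule th_pos)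
  then have "1 / th (x 1) \<noteq> 0" by simp
  then show ?thesis
    unfolding supertile_rank_def
    by (rule group_rank_int_span_mono_scaleR[OF _ supertile_returns_shiftS[OF x nonempty]])
qed

lemma AE_supertile_rank_eq_const:
  assumes prob: "prob_space \<mu>" and sets_mu: "sets \<mu> = sets (SigmaM N)"
    and shift_meas: "shiftS \<in> \<mu> \<rightarrow>\<^sub>M \<mu>" and invariant: "distr \<mu> \<mu> shiftS = \<mu>"
    and ergodic: "ergodic_shift \<mu>" and nonempty: "\<forall>j\<in>{1..M}. t j \<noteq> {}"
  shows "\<exists>r. AE x in \<mu>. supertile_rank x = r"
proof -
  interpret prob_space \<mu> by (rule prob)
  have space: "space \<mu> = space (SigmaM N)" using sets_mu by (rule sets_eq_imp_space_eq)
  have sets: "{x \<in> space \<mu>. enat c \<le> supertile_rank x} \<in> sets \<mu>" for c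
    unfolding space sets_mu by (rule supertile_rank_level_set_sets)
  have sub: "shiftS -` {x \<in> space \<mu>. enat c \<le> supertile_rank x} \<inter> space \<mu>
      \<subseteq> {x \<in> space \<mu>. enat c \<le> supertile_rank x}" for c
    using supertile_rank_shiftS_le[OF valid_seq_if_in_space nonempty] order.trans
    unfolding space by blast
  have "measure \<mu> {x \<in> space \<mu>. enat c \<le> supertile_rank x} \<in> {0, 1}" for c
    by (rule ergodic_shift_trivial_if_subinvariant[OF prob shift_meas invariant ergodic sets sub])
  then show ?thesis
    by (rule AE_eq_const_if_level_sets_trivial[OF sets])
qed

end

theorem corollary3:
  fixes t :: "nat \<Rightarrow> 'a::euclidean_space set"
    and th :: "nat \<Rightarrow> real"
    and ka :: "nat \<Rightarrow> nat \<Rightarrow> nat \<Rightarrow> nat"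
    and ta :: "nat \<Rightarrow> nat \<Rightarrow> nat \<Rightarrow> nat \<Rightarrow> 'a"
    and M N :: nat
    and \<mu> :: "(int \<Rightarrow> nat) measure"
  assumes rules: "subst_rules M N t th ka ta"
    and compat: "compatible M N t th ka ta"
    and prob: "prob_space \<mu>"
    and sets_mu: "sets \<mu> = sets (SigmaM N)"
    and shift_meas: "shiftS \<in> \<mu> \<rightarrow>\<^sub>M \<mu>"
    and invariant: "distr \<mu> \<mu> shiftS = \<mu>"
    and ergodic: "ergodic_shift \<mu>"
    and minimal: "minimal_measure M ka \<mu>"
  shows "\<exists>r. AE x in \<mu>. rank_x M t th ka ta x = r"
proof -
  interpret subst_system M N t th ka ta by (rule subst_system.intro[OF rules])
  interpret prob_space \<mu> by (rule prob)
  have space: "space \<mu> = space (SigmaM N)" using sets_mu by (rule sets_eq_imp_space_eq)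
  have AE_minimal: "AE x in \<mu>. valid_seq N x \<and> minimal_seq x"
    using minimal AE_space unfolding minimal_measure_def
    by eventually_elim (simp add: space valid_seq_if_in_space minimal_seqI)
  show ?thesis
  proof (cases "\<exists>j0\<in>{1..M}. interior (t j0) \<noteq> {}")
    case False
    then show ?thesis
      using Omega_empty_if_interiors_empty by (simp add: rank_x_def Lambda_def)
  next
    case True
    then obtain j0 where j0: "j0 \<in> {1..M}" "interior (t j0) \<noteq> {}" by blast
    obtain x0 where "valid_seq N x0" "minimal_seq x0"
      using ex_if_AE[OF AE_minimal] by blast
    then have "\<forall>j\<in>{1..M}. t j \<noteq> {}"
      using prototiles_nonempty j0 interior_subset by blast
    then obtain r where "AE x in \<mu>. supertile_rank x = r"
      using AE_supertile_rank_eq_const[OF prob sets_mu shift_meas invariant ergodic] by blast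
    with AE_minimal have "AE x in \<mu>. rank_x M t th ka ta x = r"
      by eventually_elim (use rank_x_eq_supertile_rank j0 in simp)
    then show ?thesis ..
  qed
qed

end
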